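(* Given any three distinct points $z_1,z_2,z_3\in\mathbb{C}_\infty$ and any three distinct points $w_1,w_2,w_3\in\mathbb{C}_\infty$, there is a unique linear fractional transformation $f:\mathbb{C}_\infty\to\mathbb{C}_\infty$ (unique as a function on $\mathbb{C}_\infty$) such that $f(z_1)=w_1$, $f(z_2)=w_2$ and $f(z_3)=w_3$.
   Context: The extended complex plane is $\mathbb{C}_\infty=\mathbb{C}\cup\{\infty\}$, the disjoint union of $\mathbb{C}$ and one extra point $\infty$. A linear fractional transformation (Möbius transformation) is a function $f:\mathbb{C}_\infty\to\mathbb{C}_\infty$ given by some $a,b,c,d\in\mathbb{C}$ with $ad-bc\neq 0$ as follows. If $c=0$: $f(z)=(a/d)z+(b/d)$ for $z\in\mathbb{C}$ and $f(\infty)=\infty$. If $c\neq 0$: $f(z)=\frac{az+b}{cz+d}$ for $z\in\mathbb{C}$, $z\neq -d/c$; $f(-d/c)=\infty$; and $f(\infty)=a/c$. *)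

theory Defs
  imports "HOL-Analysis.Analysis"
begin

datatype ecomplex = Fin complex | Infty

text \<open>
  The parameters are meant to satisfy \<open>a * d - b * c \<noteq> 0\<close>; this is imposed in
  \<open>linear_fractional\<close>, so the total definition is never used at degenerate parameters.
\<close>

fun lft :: "complex \<Rightarrow> complex \<Rightarrow> complex \<Rightarrow> complex \<Rightarrow> ecomplex \<Rightarrow> ecomplex" where
  "lft a b c d (Fin z) =
     (if c = 0 then Fin ((a / d) * z + b / d)
      else if z = - d / c then Infty
      else Fin ((a * z + b) / (c * z + d)))"
| "lft a b c d Infty = (if c = 0 then Infty else Fin (a / c))"

definition linear_fractional :: "(ecomplex \<Rightarrow> ecomplex) \<Rightarrow> bool" where
  "linear_fractional f \<longleftrightarrow> (\<exists>a b c d. a * d - b * c \<noteq> 0 \<and> f = lft a b c d)"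

end

theory Submission
  imports Defs
begin

text \<open>
  In homogeneous coordinates \<open>[x : y]\<close> a linear fractional transformation is the action of an
  invertible matrix, so these transformations form a group. Some element of the group sends any
  three distinct points to \<open>0, 1, \<infinity>\<close>, and only the identity fixes \<open>0, 1, \<infinity>\<close>; hence the group
  acts simply transitively on triples of distinct points.
\<close>

text \<open>The point \<open>[x : y]\<close> of the projective line. The pair \<open>(0, 0)\<close>
  names no point but also gets the value \<open>Infty\<close>, which is why later lemmas demand a
  nonzero pair.\<close>

definition hpoint :: "complex \<Rightarrow> complex \<Rightarrow> ecomplex" where
  "hpoint x y = (if y = 0 then Infty else Fin (x / y))"

lemma ecomplex_hpointE:
  obtains x y where "p = hpoint x y" "x \<noteq> 0 \<or> y \<noteq> 0"
proof (cases p)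
  case (Fin z)
  then show ?thesis using that[of z 1] by (simp add: hpoint_def)
next
  case Infty
  then show ?thesis using that[of 1 0] by (simp add: hpoint_def)
qed

text \<open>Applying the adjugate matrix to the image vector returns the determinant times
  \<open>(x, y)\<close>, so a zero image would force \<open>x = y = 0\<close>. Images are thus again
  valid homogeneous coordinates.\<close>

lemma matrix_image_nonzero:
  fixes a b c d x y :: complex
  assumes det: "a * d - b * c \<noteq> 0" and nz: "x \<noteq> 0 \<or> y \<noteq> 0"
  shows "a * x + b * y \<noteq> 0 \<or> c * x + d * y \<noteq> 0"
proof (rule ccontr)
  assume "\<not> ?thesis"
  then have u: "a * x + b * y = 0" and v: "c * x + d * y = 0" by auto
  have "(a * d - b * c) * x = d * (a * x + b * y) - b * (c * x + d * y)"
    and "(a * d - b * c) * y = a * (c * x + d * y) - c * (a * x + b * y)"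
    by (simp_all add: algebra_simps)
  then show False using u v det nz by simp
qed

text \<open>One linear formula absorbs all cases of \<open>lft\<close>: \<open>Infty\<close> is
  \<open>y = 0\<close>, and the pole is where the second image coordinate vanishes.\<close>

lemma lft_hpoint:
  assumes det: "a * d - b * c \<noteq> 0" and nz: "x \<noteq> 0 \<or> y \<noteq> 0"
  shows "lft a b c d (hpoint x y) = hpoint (a * x + b * y) (c * x + d * y)"
proof (cases "y = 0")
  case True
  then show ?thesis using nz by (simp add: hpoint_def)
next
  case False
  show ?thesis
  proof (cases "c = 0")
    case True
    then have "d \<noteq> 0" using det by auto
    then show ?thesis using True False by (simp add: hpoint_def add_divide_distrib)
  next
    case c: False
    have "x / y = - d / c \<longleftrightarrow> c * x + d * y = 0"
      using c False frac_eq_eq[of y c x "- d"]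
      by (simp only: eq_neg_iff_add_eq_0 mult_minus_left mult.commute[of x c] simp_thms)
    moreover have "(a * (x / y) + b) / (c * (x / y) + d) = (a * x + b * y) / (c * x + d * y)"
    proof -
      have "a * (x / y) + b = (a * x + b * y) / y" "c * (x / y) + d = (c * x + d * y) / y"
        using False by (simp_all add: add_divide_distrib)
      then show ?thesis using False by simp
    qed
    ultimately show ?thesis using c False by (simp add: hpoint_def)
  qed
qed

text \<open>On homogeneous coordinates both sides are linear, so this is associativity of the matrix
  action on a vector.\<close>

lemma lft_compose:
  assumes det: "a * d - b * c \<noteq> 0" and det': "a' * d' - b' * c' \<noteq> 0"
  shows "lft a b c d \<circ> lft a' b' c' d' =
    lft (a * a' + b * c') (a * b' + b * d') (c * a' + d * c') (c * b' + d * d')"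
proof
  fix p
  obtain x y where p: "p = hpoint x y" and nz: "x \<noteq> 0 \<or> y \<noteq> 0" by (rule ecomplex_hpointE)
  \<comment> \<open>The determinant is multiplicative, so the product matrix is invertible as
    well.\<close>
  have "(a * a' + b * c') * (c * b' + d * d') - (a * b' + b * d') * (c * a' + d * c')
      = (a * d - b * c) * (a' * d' - b' * c')"
    by (simp add: algebra_simps)
  then have "(a * a' + b * c') * (c * b' + d * d') - (a * b' + b * d') * (c * a' + d * c') \<noteq> 0"
    using det det' by simp
  from lft_hpoint[OF this nz]
  show "(lft a b c d \<circ> lft a' b' c' d') p =
    lft (a * a' + b * c') (a * b' + b * d') (c * a' + d * c') (c * b' + d * d') p"
    using lft_hpoint[OF det' nz] lft_hpoint[OF det matrix_image_nonzero[OF det' nz]]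
    by (simp add: p algebra_simps)
qed

lemma lft_scalar: "e \<noteq> 0 \<Longrightarrow> lft e 0 0 e = id"
proof
  fix p assume "e \<noteq> 0"
  then show "lft e 0 0 e p = id p" by (cases p) auto
qed

lemma linear_fractional_compose:
  assumes "linear_fractional f" "linear_fractional g"
  shows "linear_fractional (f \<circ> g)"
proof -
  obtain a b c d where det: "a * d - b * c \<noteq> 0" and f: "f = lft a b c d"
    using assms(1) unfolding linear_fractional_def by blast
  obtain a' b' c' d' where det': "a' * d' - b' * c' \<noteq> 0" and g: "g = lft a' b' c' d'"
    using assms(2) unfolding linear_fractional_def by blast
  have "(a * a' + b * c') * (c * b' + d * d') - (a * b' + b * d') * (c * a' + d * c')
      = (a * d - b * c) * (a' * d' - b' * c')"
    by (simp add: algebra_simps)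
  then have "(a * a' + b * c') * (c * b' + d * d') - (a * b' + b * d') * (c * a' + d * c') \<noteq> 0"
    using det det' by simp
  then show ?thesis
    unfolding linear_fractional_def f g lft_compose[OF det det'] by blast
qed

text \<open>The adjugate serves as inverse: its product with the matrix, in either order, is the
  determinant times the identity, and scalar matrices act trivially.\<close>

lemma linear_fractional_inverse:
  assumes "linear_fractional f"
  obtains g where "linear_fractional g" "g \<circ> f = id" "f \<circ> g = id"
proof -
  obtain a b c d where det: "a * d - b * c \<noteq> 0" and f: "f = lft a b c d"
    using assms unfolding linear_fractional_def by blast
  have det': "d * a - (- b) * (- c) \<noteq> 0" using det by (simp add: mult.commute)
  have "linear_fractional (lft d (- b) (- c) a)"
    unfolding linear_fractional_def using det' by blast
  moreover have "lft d (- b) (- c) a \<circ> f = id" "f \<circ> lft d (- b) (- c) a = id"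
    using lft_compose[OF det' det] lft_compose[OF det det'] lft_scalar[OF det]
    by (simp_all add: f algebra_simps)
  ultimately show ?thesis by (rule that)
qed

text \<open>For finite points the map is the cross-ratio
  \<open>(z - u) (v - w) / ((z - w) (v - u))\<close>. If one point is \<open>Infty\<close>, the two
  factors containing it are dropped, as in the limit.\<close>

lemma linear_fractional_normalize:
  assumes "z1 \<noteq> z2" "z1 \<noteq> z3" "z2 \<noteq> z3"
  obtains f where "linear_fractional f" "f z1 = Fin 0" "f z2 = Fin 1" "f z3 = Infty"
proof -
  note intro = that
  have *: thesis if "a * d - b * c \<noteq> 0"
    "lft a b c d z1 = Fin 0" "lft a b c d z2 = Fin 1" "lft a b c d z3 = Infty" for a b c d
    using that by (intro intro[of "lft a b c d"]) (auto simp: linear_fractional_def)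
  consider (fin) u v w where "z1 = Fin u" "z2 = Fin v" "z3 = Fin w"
    | (inf1) v w where "z1 = Infty" "z2 = Fin v" "z3 = Fin w"
    | (inf2) u w where "z1 = Fin u" "z2 = Infty" "z3 = Fin w"
    | (inf3) u v where "z1 = Fin u" "z2 = Fin v" "z3 = Infty"
    using assms by (cases z1; cases z2; cases z3) auto
  then show thesis
  proof cases
    case fin
    then have ne: "u \<noteq> v" "u \<noteq> w" "v \<noteq> w" using assms by auto
    \<comment> \<open>The coefficients come from expanding the numerator and denominator of the
      cross-ratio in \<open>z\<close>.\<close>
    have "(v - w) * (- w * (v - u)) - (- u * (v - w)) * (v - u) = (v - w) * (v - u) * (u - w)"
      by (simp add: algebra_simps)
    then have det: "(v - w) * (- w * (v - u)) - (- u * (v - w)) * (v - u) \<noteq> 0"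
      using ne by simp
    have pole: "- (- w * (v - u)) / (v - u) = w" using ne by simp
    \<comment> \<open>The numerator vanishes at \<open>u\<close>; at \<open>v\<close> it equals the
      denominator, whose value there is nonzero.\<close>
    have "(v - w) * u + - u * (v - w) = 0"
      "(v - w) * v + - u * (v - w) = (v - u) * v + - w * (v - u)"
      by (simp_all add: algebra_simps)
    moreover have "(v - u) * v + - w * (v - u) = (v - u) * (v - w)"
      by (simp add: algebra_simps)
    then have "(v - u) * v + - w * (v - u) \<noteq> 0" using ne by simp
    ultimately show ?thesis using fin ne pole
      by (intro *[OF det]) (simp_all del: mult_minus_left)
  next
    case inf1
    then show ?thesis using assms
      by (intro *[where a = 0 and b = "v - w" and c = 1 and d = "- w"]) auto
  next
    case inf2
    then show ?thesis using assms
      by (intro *[where a = 1 and b = "- u" and c = 1 and d = "- w"]) auto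
  next
    case inf3
    then show ?thesis using assms
      by (intro *[where a = 1 and b = "- u" and c = 0 and d = "v - u"])
        (auto simp: diff_divide_distrib [symmetric])
  qed
qed

text \<open>Fixing \<open>Infty\<close> forces \<open>c = 0\<close>, fixing 0 then forces
  \<open>b = 0\<close>, and fixing 1 forces \<open>a = d\<close>, leaving a scalar matrix.\<close>

lemma linear_fractional_fix_eq_id:
  assumes "linear_fractional f" "f (Fin 0) = Fin 0" "f (Fin 1) = Fin 1" "f Infty = Infty"
  shows "f = id"
proof -
  obtain a b c d where det: "a * d - b * c \<noteq> 0" and f: "f = lft a b c d"
    using assms(1) unfolding linear_fractional_def by blast
  have c: "c = 0" using assms(4) by (simp add: f split: if_splits)
  with det have ad: "a \<noteq> 0" "d \<noteq> 0" by auto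
  have b: "b = 0" using assms(2) c ad by (simp add: f)
  have "a = d" using assms(3) b c ad by (simp add: f)
  then show ?thesis using b c ad by (simp add: f lft_scalar)
qed

theorem theorem5p2:
  fixes z1 z2 z3 w1 w2 w3 :: ecomplex
  assumes "z1 \<noteq> z2" and "z1 \<noteq> z3" and "z2 \<noteq> z3"
    and "w1 \<noteq> w2" and "w1 \<noteq> w3" and "w2 \<noteq> w3"
  shows "\<exists>!f. linear_fractional f \<and> f z1 = w1 \<and> f z2 = w2 \<and> f z3 = w3"
proof -
  obtain h where h: "linear_fractional h" "h z1 = Fin 0" "h z2 = Fin 1" "h z3 = Infty"
    using linear_fractional_normalize[OF assms(1-3)] .
  obtain k where k: "linear_fractional k" "k w1 = Fin 0" "k w2 = Fin 1" "k w3 = Infty"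
    using linear_fractional_normalize[OF assms(4-6)] .
  obtain h' where h': "linear_fractional h'" "h' \<circ> h = id" "h \<circ> h' = id"
    using linear_fractional_inverse[OF h(1)] .
  obtain k' where k': "linear_fractional k'" "k' \<circ> k = id" "k \<circ> k' = id"
    using linear_fractional_inverse[OF k(1)] .
  have h'h: "h' (h p) = p" and k'k: "k' (k p) = p" for p
    using h'(2) k'(2) by (simp_all add: fun_eq_iff)
  show ?thesis
  proof (rule ex1I[of _ "k' \<circ> h"])
    show "linear_fractional (k' \<circ> h) \<and> (k' \<circ> h) z1 = w1 \<and> (k' \<circ> h) z2 = w2 \<and> (k' \<circ> h) z3 = w3"
      using linear_fractional_compose[OF k'(1) h(1)] h k k'k[of w1] k'k[of w2] k'k[of w3] by simp
  next
    fix f assume f: "linear_fractional f \<and> f z1 = w1 \<and> f z2 = w2 \<and> f z3 = w3"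
    \<comment> \<open>This map runs from 0, 1, \<open>Infty\<close> through the \<open>z\<close>
      triple and the \<open>w\<close> triple back to 0, 1, \<open>Infty\<close>.\<close>
    have "k \<circ> f \<circ> h' = id"
    proof (rule linear_fractional_fix_eq_id)
      show "linear_fractional (k \<circ> f \<circ> h')"
        using f k(1) h'(1) by (intro linear_fractional_compose) auto
      show "(k \<circ> f \<circ> h') (Fin 0) = Fin 0" using f k h h'h[of z1] by simp
      show "(k \<circ> f \<circ> h') (Fin 1) = Fin 1" using f k h h'h[of z2] by simp
      show "(k \<circ> f \<circ> h') Infty = Infty" using f k h h'h[of z3] by simp
    qed
    then have "k (f (h' q)) = q" for q by (simp add: fun_eq_iff)
    \<comment> \<open>Take \<open>q = h p\<close> and apply \<open>k'\<close> to both sides.\<close>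
    then have "f p = k' (h p)" for p using h'h[of p] k'k[of "f p"] by metis
    then show "f = k' \<circ> h" by (simp add: fun_eq_iff)
  qed
qed

end
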